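(* Let $N\ge 2$, let $z_{1,N}<\dots<z_{N,N}$ be the zeros of the Hermite polynomial $H_N$, and let $(\hat Q_n^{(N)})_{n=0}^{N-1}$ be the monic polynomials, $\deg \hat Q_n^{(N)}=n$, which are orthogonal with respect to the empirical measure $\mu_N=\frac1N(\delta_{z_{1,N}}+\dots+\delta_{z_{N,N}})$. Then $$\hat Q_0^{(N)}=1,\qquad \hat Q_1^{(N)}(x)=x,\qquad \hat Q_{k+1}^{(N)}(x)=x\,\hat Q_k^{(N)}(x)-\frac{N-k}{2}\,\hat Q_{k-1}^{(N)}(x)$$ for $k=1,\dots,N-2$.
   Context: $H_N$ denotes the classical (physicists') Hermite polynomial of degree $N$, orthogonal with respect to $e^{-x^2}$ on $\mathbb R$. *)

theory Defs
  imports "HOL-Probability.Probability" "HOL-Computational_Algebra.Polynomial"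
    "HOL-Real_Asymp.Real_Asymp"
begin

section \<open>Orthogonal polynomials\<close>

text \<open>
  \<open>I\<close> is the range of degrees: all of \<open>UNIV\<close> for a measure with infinite support, an initial
  segment for a finitely supported one. The condition \<open>p n \<noteq> 0\<close> matters for \<open>n = 0\<close> only, since
  \<open>degree 0 = 0\<close> in the library. The Bochner integral of a non-integrable function is \<open>0\<close>, so the
  definition is meaningful only for measures with finite moments, as are the two used below.
\<close>

definition orthogonal_polys :: "real measure \<Rightarrow> nat set \<Rightarrow> (nat \<Rightarrow> real poly) \<Rightarrow> bool" where
  "orthogonal_polys M I p \<longleftrightarrow>
     (\<forall>n\<in>I. p n \<noteq> 0 \<and> degree (p n) = n) \<and>
     (\<forall>m\<in>I. \<forall>n\<in>I. m \<noteq> n \<longrightarrow> (LINT x|M. poly (p m) x * poly (p n) x) = 0)"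

definition monic_orthogonal_polys :: "real measure \<Rightarrow> nat set \<Rightarrow> (nat \<Rightarrow> real poly) \<Rightarrow> bool" where
  "monic_orthogonal_polys M I p \<longleftrightarrow> orthogonal_polys M I p \<and> (\<forall>n\<in>I. lead_coeff (p n) = 1)"


section \<open>Empirical measures\<close>

definition empirical_measure :: "nat \<Rightarrow> (nat \<Rightarrow> real) \<Rightarrow> real measure" where
  "empirical_measure N z =
     measure_of UNIV (sets borel) (\<lambda>A. (\<Sum>i=1..N. emeasure (return borel (z i)) A) / of_nat N)"

lemma sets_empirical_measure [simp, measurable_cong]: "sets (empirical_measure N z) = sets borel"
  and space_empirical_measure [simp]: "space (empirical_measure N z) = UNIV"
  unfolding empirical_measure_def
  using sets.sigma_sets_eq[of "borel :: real measure"] by simp_all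

lemma empirical_measure_eq_distr:
  assumes "N \<ge> 1"
  shows "empirical_measure N z = distr (uniform_count_measure {1..N}) borel z"
proof -
  let ?D = "distr (uniform_count_measure {1..N}) borel z"
  have meas: "z \<in> measurable (uniform_count_measure {1..N}) borel"
    by (simp add: measurable_def space_uniform_count_measure sets_uniform_count_measure)
  have "emeasure ?D A = (\<Sum>i=1..N. emeasure (return borel (z i)) A) / of_nat N"
    if A: "A \<in> sets borel" for A
  proof -
    have "emeasure ?D A = emeasure (uniform_count_measure {1..N}) (z -` A \<inter> {1..N})"
      using A meas by (simp add: emeasure_distr space_uniform_count_measure)
    also have "\<dots> = ennreal (card (z -` A \<inter> {1..N}) / N)"
      by (subst emeasure_uniform_count_measure) auto
    also have "\<dots> = of_nat (card (z -` A \<inter> {1..N})) / of_nat N"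
      using assms by (simp add: divide_ennreal [symmetric] ennreal_of_nat_eq_real_of_nat)
    also have "of_nat (card (z -` A \<inter> {1..N})) = (\<Sum>i=1..N. emeasure (return borel (z i)) A)"
      using A by (simp add: indicator_def sum.If_cases Int_def conj_commute)
    finally show ?thesis .
  qed
  then have "empirical_measure N z = measure_of UNIV (sets borel) (emeasure ?D)"
    unfolding empirical_measure_def
    using sets.sigma_sets_eq[of "borel :: real measure"] by (intro measure_of_eq) auto
  also have "\<dots> = ?D"
    using measure_of_of_measure[of ?D] by simp
  finally show ?thesis .
qed

lemma integral_empirical_measure:
  fixes f :: "real \<Rightarrow> real"
  assumes "N \<ge> 1" and "f \<in> borel_measurable borel"
  shows "(LINT x|empirical_measure N z. f x) = (\<Sum>i=1..N. f (z i)) / N"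
proof -
  have meas: "z \<in> measurable (uniform_count_measure {1..N}) borel"
    by (simp add: measurable_def space_uniform_count_measure sets_uniform_count_measure)
  show ?thesis
    using assms meas
    by (simp add: empirical_measure_eq_distr integral_distr uniform_count_measure_def
        lebesgue_integral_point_measure_finite sum_divide_distrib)
qed


section \<open>Hermite polynomials\<close>

definition hermite_measure :: "real measure" where
  "hermite_measure = density lborel (\<lambda>x. exp (- x\<^sup>2))"

text \<open>Orthogonality fixes the polynomials up to scalars; the leading coefficient \<open>2 ^ n\<close> is the
  physicists' normalisation. Existence and uniqueness are shown in \<open>ex1_hermite\<close>.\<close>

definition hermite :: "nat \<Rightarrow> real poly" where
  "hermite = (THE H. orthogonal_polys hermite_measure UNIV H \<and> (\<forall>n. lead_coeff (H n) = 2 ^ n))"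

lemma integral_hermite_measure:
  "(LINT x|hermite_measure. poly p x) = (LINT x|lborel. exp (- x\<^sup>2) * poly p x)"
  unfolding hermite_measure_def
  by (intro integral_real_density) (auto intro!: borel_measurable_continuous_onI continuous_intros)

lemma integrable_hermite_measure_iff:
  "integrable hermite_measure (poly p) \<longleftrightarrow> integrable lborel (\<lambda>x. exp (- x\<^sup>2) * poly p x)"
  unfolding hermite_measure_def
  by (intro integrable_real_density) (auto intro!: borel_measurable_continuous_onI continuous_intros)

lemma integrable_exp_poly: "integrable lborel (\<lambda>x::real. exp (- x\<^sup>2) * poly p x)"
proof -
  have "integrable lborel (\<lambda>x::real. exp (- x\<^sup>2) * x ^ k)" for k
  proof -
    have "integrable lborel (\<lambda>x. sqrt pi * (normal_density 0 (1 / sqrt 2) x * (x - 0) ^ k))"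
      by (intro integrable_mult_right integrable_normal_moment) simp
    also have "(\<lambda>x. sqrt pi * (normal_density 0 (1 / sqrt 2) x * (x - 0) ^ k)) =
                 (\<lambda>x. exp (- x\<^sup>2) * x ^ k)"
      by (simp add: normal_density_def fun_eq_iff power_divide)
    finally show ?thesis .
  qed
  then have "integrable lborel (\<lambda>x. \<Sum>k\<le>degree p. coeff p k * (exp (- x\<^sup>2) * x ^ k))"
    by (intro Bochner_Integration.integrable_sum integrable_mult_right) auto
  then show ?thesis
    by (simp add: poly_altdef sum_distrib_left mult_ac)
qed

lemma integrable_hermite_measure: "integrable hermite_measure (poly p)"
  by (simp add: integrable_hermite_measure_iff integrable_exp_poly)

lemma tendsto_exp_poly:
  "((\<lambda>x::real. exp (- x\<^sup>2) * poly p x) \<longlongrightarrow> 0) at_top"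
  "((\<lambda>x::real. exp (- x\<^sup>2) * poly p x) \<longlongrightarrow> 0) at_bot"
proof -
  have top: "((\<lambda>x::real. exp (- x\<^sup>2) * poly p x) \<longlongrightarrow> 0) at_top" for p
  proof -
    have "((\<lambda>x::real. exp (- x\<^sup>2) * x ^ k) \<longlongrightarrow> 0) at_top" for k
      by real_asymp
    then have "((\<lambda>x. \<Sum>k\<le>degree p. coeff p k * (exp (- x\<^sup>2) * x ^ k)) \<longlongrightarrow>
                 (\<Sum>k\<le>degree p. coeff p k * 0)) at_top"
      by (intro tendsto_intros) auto
    then show ?thesis
      by (simp add: poly_altdef sum_distrib_left mult_ac)
  qed
  show "((\<lambda>x::real. exp (- x\<^sup>2) * poly p x) \<longlongrightarrow> 0) at_top"
    by (rule top)
  show "((\<lambda>x::real. exp (- x\<^sup>2) * poly p x) \<longlongrightarrow> 0) at_bot"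
    using top[of "pcompose p [:0, -1:]"] by (simp add: filterlim_at_bot_mirror poly_pcompose)
qed

abbreviation hermite_integral :: "real poly \<Rightarrow> real" where
  "hermite_integral p \<equiv> (LINT x|hermite_measure. poly p x)"

lemma hermite_integral_linear:
  "hermite_integral (p + q) = hermite_integral p + hermite_integral q"
  "hermite_integral (p - q) = hermite_integral p - hermite_integral q"
  "hermite_integral (smult c p) = c * hermite_integral p"
  by (simp_all add: integrable_hermite_measure)

text \<open>Integration by parts against \<open>exp (- x\<^sup>2)\<close>.\<close>

lemma hermite_integral_pderiv: "hermite_integral (pderiv p) = hermite_integral ([:0, 2:] * p)"
proof -
  let ?F = "\<lambda>x::real. exp (- x\<^sup>2) * poly p x"
  let ?f = "\<lambda>x::real. exp (- x\<^sup>2) * poly (pderiv p - [:0, 2:] * p) x"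
  have "(LBINT x=-\<infinity>..\<infinity>. ?f x) = 0 - 0"
  proof (rule interval_integral_FTC_integrable)
    show "(?F has_vector_derivative ?f x) (at x)" for x
      unfolding has_real_derivative_iff_has_vector_derivative [symmetric]
      by (auto intro!: derivative_eq_intros simp: algebra_simps)
    show "isCont ?f x" for x
      by (intro continuous_intros)
    show "set_integrable lborel (einterval (-\<infinity>) \<infinity>) ?f"
      using integrable_exp_poly[of "pderiv p - [:0, 2:] * p"]
      by (simp add: set_integrable_def einterval_def)
    show "((?F \<circ> real_of_ereal) \<longlongrightarrow> 0) (at_right (-\<infinity>))"
      using tendsto_exp_poly(2)[of p] by (simp add: ereal_tendsto_simps1)
    show "((?F \<circ> real_of_ereal) \<longlongrightarrow> 0) (at_left \<infinity>)"
      using tendsto_exp_poly(1)[of p] by (simp add: ereal_tendsto_simps1)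
  qed simp
  then have "(LINT x|lborel. ?f x) = 0"
    by (simp add: interval_lebesgue_integral_def set_lebesgue_integral_def einterval_def)
  then have "hermite_integral (pderiv p - [:0, 2:] * p) = 0"
    by (simp only: integral_hermite_measure)
  then show ?thesis
    by (simp only: hermite_integral_linear)
qed

lemma hermite_integral_square_eq_0:
  assumes "hermite_integral (p * p) = 0"
  shows "p = 0"
proof -
  have "(LINT x|lborel. exp (- x\<^sup>2) * poly (p * p) x) = 0"
    using assms by (simp only: integral_hermite_measure)
  then have "AE x in lborel. exp (- x\<^sup>2) * poly (p * p) x = 0"
    by (subst (asm) integral_nonneg_eq_0_iff_AE) (use integrable_exp_poly[of "p * p"] in auto)
  then have AE: "AE x in lborel. poly p x = 0"
    by simp
  show "p = 0"
  proof (rule ccontr)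
    assume "p \<noteq> 0"
    then have "{x. poly p x = 0} \<in> null_sets lborel"
      by (intro finite_imp_null_set_lborel poly_roots_finite)
    then have "AE x in lborel. poly p x \<noteq> 0"
      by (rule AE_I') auto
    with AE have "AE x in (lborel :: real measure). False"
      by eventually_elim auto
    then show False
      by (subst (asm) AE_iff_null) (simp_all add: null_sets_def)
  qed
qed

lemma orthogonal_polys_lower_degree:
  assumes H: "orthogonal_polys hermite_measure UNIV H" and "degree q < n"
  shows "hermite_integral (H n * q) = 0"
  using assms(2)
proof (induction "degree q" arbitrary: q rule: less_induct)
  case less
  define c where "c = lead_coeff q / lead_coeff (H (degree q))"
  define r where "r = q - smult c (H (degree q))"
  have nz: "H (degree q) \<noteq> 0" and deg: "degree (H (degree q)) = degree q"
    using H by (auto simp: orthogonal_polys_def)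
  have q: "q = smult c (H (degree q)) + r"
    by (simp add: r_def)
  have "hermite_integral (H n * H (degree q)) = 0"
    using H less.prems by (auto simp: orthogonal_polys_def)
  moreover have "hermite_integral (H n * r) = 0"
  proof (cases "r = 0")
    case False
    have "degree r \<le> degree q"
      unfolding r_def using deg by (intro degree_diff_le) (auto intro: order.trans[OF degree_smult_le])
    moreover have "coeff r (degree q) = 0"
    proof -
      have "coeff (H (degree q)) (degree q) \<noteq> 0"
        using nz deg by (metis leading_coeff_0_iff)
      then show ?thesis
        by (simp add: r_def c_def deg)
    qed
    ultimately have "degree r < degree q"
      using False by (metis le_neq_implies_less leading_coeff_0_iff)
    then show ?thesis
      using less.hyps[of r] less.prems by linarith
  qed simp
  ultimately show ?case
    by (subst q) (simp only: ring_distribs mult_smult_right hermite_integral_linear)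
qed

lemma orthogonal_polys_hermite_measure_unique:
  assumes G: "orthogonal_polys hermite_measure UNIV G" "\<And>n. lead_coeff (G n) = 2 ^ n"
    and H: "orthogonal_polys hermite_measure UNIV H" "\<And>n. lead_coeff (H n) = 2 ^ n"
  shows "G = H"
proof
  fix n
  define d where "d = G n - H n"
  have deg: "degree (G n) = n" "degree (H n) = n"
    using G(1) H(1) by (auto simp: orthogonal_polys_def)
  have "d = 0"
  proof (rule ccontr)
    assume "d \<noteq> 0"
    have "degree d \<le> n"
      unfolding d_def using deg by (intro degree_diff_le) auto
    moreover have "coeff d n = 0"
      using G(2)[of n] H(2)[of n] deg by (simp add: d_def)
    ultimately have "degree d < n"
      using \<open>d \<noteq> 0\<close> by (metis le_neq_implies_less leading_coeff_0_iff)
    then have "hermite_integral (G n * d - H n * d) = 0"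
      unfolding hermite_integral_linear
      using orthogonal_polys_lower_degree[OF G(1), of d n] orthogonal_polys_lower_degree[OF H(1), of d n]
      by linarith
    then have "hermite_integral (d * d) = 0"
      by (simp only: d_def left_diff_distrib)
    then show False
      using hermite_integral_square_eq_0 \<open>d \<noteq> 0\<close> by blast
  qed
  then show "G n = H n"
    by (simp add: d_def)
qed

text \<open>Existence: the recursion obtained from Rodrigues' formula.\<close>

primrec hermite_rodrigues :: "nat \<Rightarrow> real poly" where
  "hermite_rodrigues 0 = 1"
| "hermite_rodrigues (Suc n) = [:0, 2:] * hermite_rodrigues n - pderiv (hermite_rodrigues n)"

lemma hermite_integral_rodrigues_lower_degree:
  "degree q < n \<Longrightarrow> hermite_integral (hermite_rodrigues n * q) = 0"
proof (induction n arbitrary: q)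
  case (Suc n)
  let ?h = "hermite_rodrigues n"
  have "hermite_rodrigues (Suc n) * q = [:0, 2:] * (?h * q) - pderiv ?h * q"
    by (simp only: hermite_rodrigues.simps left_diff_distrib mult.assoc)
  then have "hermite_integral (hermite_rodrigues (Suc n) * q) =
          hermite_integral (pderiv (?h * q)) - hermite_integral (pderiv ?h * q)"
    by (simp only: hermite_integral_linear hermite_integral_pderiv)
  also have "\<dots> = hermite_integral (?h * pderiv q)"
    by (simp only: pderiv_mult hermite_integral_linear) (simp add: mult.commute)
  also have "\<dots> = 0"
  proof (cases "degree q = 0")
    case True
    then show ?thesis by (simp add: pderiv_eq_0_iff[THEN iffD2])
  next
    case False
    then show ?thesis using Suc by (simp add: degree_pderiv)
  qed
  finally show ?case .
qed simp

lemma degree_lead_coeff_hermite_rodrigues: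
  "degree (hermite_rodrigues n) = n \<and> lead_coeff (hermite_rodrigues n) = 2 ^ n"
proof (induction n)
  case (Suc n)
  let ?h = "hermite_rodrigues n"
  have nz: "?h \<noteq> 0"
    using Suc by auto
  have deg: "degree ([:0, 2:] * ?h) = Suc n"
    using nz Suc by (subst degree_mult_eq) auto
  have less: "degree (- pderiv ?h) < degree ([:0, 2:] * ?h)"
    using deg Suc by (simp add: degree_pderiv)
  have eq: "hermite_rodrigues (Suc n) = - pderiv ?h + [:0, 2:] * ?h"
    by simp
  have "degree (hermite_rodrigues (Suc n)) = Suc n"
    unfolding eq using degree_add_eq_right[OF less] deg by simp
  moreover have "lead_coeff (hermite_rodrigues (Suc n)) = lead_coeff ([:0, 2:] * ?h)"
    unfolding eq using less by (rule lead_coeff_add_le)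
  moreover have "lead_coeff ([:0, 2:] * ?h) = 2 ^ Suc n"
    unfolding lead_coeff_mult using Suc by (metis (no_types, lifting) lead_coeff_pCons(1) 
        lead_coeff_pCons(2) one_neq_zero pCons_eq_0_iff power_Suc zero_neq_numeral)
  ultimately show ?case
    by (simp only:)
qed simp

lemma orthogonal_polys_hermite_rodrigues:
  "orthogonal_polys hermite_measure UNIV hermite_rodrigues"
proof -
  have "hermite_integral (hermite_rodrigues m * hermite_rodrigues n) = 0" if "m \<noteq> n" for m n
    using that hermite_integral_rodrigues_lower_degree[of "hermite_rodrigues m" n]
      hermite_integral_rodrigues_lower_degree[of "hermite_rodrigues n" m]
      degree_lead_coeff_hermite_rodrigues
    by (cases m n rule: linorder_cases) (auto simp: mult.commute)
  moreover have "hermite_rodrigues n \<noteq> 0" for n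
    using degree_lead_coeff_hermite_rodrigues[of n] by auto
  ultimately show ?thesis
    using degree_lead_coeff_hermite_rodrigues by (auto simp: orthogonal_polys_def)
qed

theorem ex1_hermite:
  "\<exists>!H. orthogonal_polys hermite_measure UNIV H \<and> (\<forall>n. lead_coeff (H n) = 2 ^ n)"
  using orthogonal_polys_hermite_rodrigues degree_lead_coeff_hermite_rodrigues
    orthogonal_polys_hermite_measure_unique by (intro ex1I[of _ hermite_rodrigues]) blast+

lemma hermite_eq_rodrigues: "hermite = hermite_rodrigues"
  unfolding hermite_def using orthogonal_polys_hermite_rodrigues degree_lead_coeff_hermite_rodrigues
  by (intro the1_equality ex1_hermite) blast

end

theory Submission
  imports Defs
begin

text \<open>
  Modulo \<open>H\<^sub>N\<close> the recursion of the Hermite polynomials can be run downwards from \<open>H\<^bsub>N-1\<^esub>\<close>: if \<open>P\<^sub>k\<close>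
  denotes the solution of the claimed recursion, then \<open>H\<^bsub>N-1\<^esub> P\<^sub>k = c\<^sub>k H\<^bsub>N-1-k\<^esub>\<close> at every zero
  of \<open>H\<^sub>N\<close>. As \<open>H\<^sub>N' = 2 N H\<^bsub>N-1\<^esub>\<close>, the sum of \<open>P\<^sub>k q\<close> over these zeros is a multiple of the sum
  of \<open>H\<^bsub>N-1-k\<^esub> q / H\<^sub>N'\<close>, which by Lagrange interpolation is the coefficient of degree \<open>N - 1\<close>
  of \<open>H\<^bsub>N-1-k\<^esub> q\<close> up to a factor, and this vanishes for \<open>degree q < k\<close>.
\<close>

section \<open>Simple zeros and Lagrange interpolation\<close>

text \<open>At a double zero \<open>a\<close> the cofactor of \<open>x - a\<close> would still
  vanish on all of \<open>A\<close>, which is one zero more than its degree allows.\<close>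

lemma pderiv_nonzero_at_roots:
  fixes p :: "'a::field poly"
  assumes "p \<noteq> 0" and roots: "\<And>a. a \<in> A \<Longrightarrow> poly p a = 0" and card: "card A = degree p"
    and a: "a \<in> A"
  shows "poly (pderiv p) a \<noteq> 0"
proof
  assume 0: "poly (pderiv p) a = 0"
  obtain L where L: "p = [:-a, 1:] * L"
    using roots[OF a] by (auto simp: poly_eq_0_iff_dvd dvd_def)
  have nz: "L \<noteq> 0"
    using L \<open>p \<noteq> 0\<close> by auto
  have "poly (pderiv p) a = poly L a"
    unfolding L pderiv_mult by (simp add: pderiv_pCons)
  then have "A \<subseteq> {x. poly L x = 0}"
    using 0 roots by (auto simp: L)
  then have "card A \<le> degree L"
    using card_poly_roots_bound[OF nz] poly_roots_finite[OF nz] by (meson card_mono order_trans)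
  moreover have "degree p = Suc (degree L)"
    using nz unfolding L by (subst degree_mult_eq) auto
  ultimately show False
    using card by simp
qed

text \<open>The polynomials \<open>p / (x - a)\<close> are, up to the factor \<open>p'(a)\<close>,
  the Lagrange basis for the nodes \<open>A\<close>, and all have the leading coefficient of
  \<open>p\<close>. Interpolation reproduces \<open>g\<close>, and comparing coefficients of degree
  \<open>degree p - 1\<close> gives the sum.\<close>

lemma sum_poly_div_pderiv_roots:
  fixes p g :: "'a::field poly"
  assumes "p \<noteq> 0" and roots: "\<And>a. a \<in> A \<Longrightarrow> poly p a = 0" and card: "card A = degree p"
    and g: "degree g < degree p"
  shows "(\<Sum>a\<in>A. poly g a / poly (pderiv p) a) = coeff g (degree p - 1) / lead_coeff p"
proof -
  \<comment> \<open>An infinite \<open>A\<close> would have \<open>card A = 0\<close>, whereas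
    \<open>g\<close> makes \<open>degree p\<close> positive.\<close>
  have fin: "finite A"
    using card g by (metis card.infinite not_less_zero)
  define L where "L a = p div [:-a, 1:]" for a
  have L: "p = [:-a, 1:] * L a" if "a \<in> A" for a
    using roots[OF that] unfolding L_def poly_eq_0_iff_dvd by (rule dvd_mult_div_cancel [symmetric])
  have deg: "degree (L a) = degree p - 1" and lc: "lead_coeff (L a) = lead_coeff p" 
    if "a \<in> A" for a
  proof -
    have "L a \<noteq> 0"
      using L[OF that] \<open>p \<noteq> 0\<close> by auto
    then have "degree ([:-a, 1:] * L a) = Suc (degree (L a))"
      by (subst degree_mult_eq) auto
    then show "degree (L a) = degree p - 1"
      using L[OF that] by simp
    have "lead_coeff ([:-a, 1:] * L a) = lead_coeff (L a)"
      unfolding lead_coeff_mult by simp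
    then show "lead_coeff (L a) = lead_coeff p"
      using L[OF that] by simp
  qed
  have L_same: "poly (L a) a = poly (pderiv p) a" if "a \<in> A" for a
  proof -
    have "poly (pderiv p) a = poly (pderiv ([:-a, 1:] * L a)) a"
      using L[OF that] by simp
    then show ?thesis
      unfolding pderiv_mult by (simp add: pderiv_pCons)
  qed
  have L_other: "poly (L a) b = 0" if "a \<in> A" "b \<in> A" "a \<noteq> b" for a b
    using roots[OF that(2)] that(3) by (subst (asm) L[OF that(1)]) auto
  define f where "f = (\<Sum>a\<in>A. smult (poly g a / poly (pderiv p) a) (L a))"
  have "f = g"
  proof (rule poly_eqI_degree)
    fix b assume b: "b \<in> A"
    have "poly f b = (\<Sum>a\<in>A. if a = b then poly g b else 0)"
      unfolding f_def poly_sum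
      using b L_same L_other pderiv_nonzero_at_roots[OF assms(1-3)] by (intro sum.cong) auto
    then show "poly f b = poly g b"
      using b fin by simp
  next
    have "degree f \<le> degree p - 1"
      unfolding f_def using fin deg
      by (intro degree_sum_le) (auto intro: order.trans[OF degree_smult_le])
    then show "degree f < card A"
      using card g by simp
  qed (use card g in simp)
  then have "coeff g (degree p - 1) = (\<Sum>a\<in>A. poly g a / poly (pderiv p) a * coeff (L a) (degree p - 1))"
    by (metis (no_types, lifting) f_def coeff_sum coeff_smult sum.cong)
  also have "\<dots> = (\<Sum>a\<in>A. poly g a / poly (pderiv p) a) * lead_coeff p"
    unfolding sum_distrib_right using deg lc by (intro sum.cong) (auto simp del: coeff_smult)
  finally show ?thesis
    using \<open>p \<noteq> 0\<close> by simp
qed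

section \<open>Orthogonality to all lower degrees\<close>

text \<open>The \<open>p j\<close> with \<open>j < k\<close> span the polynomials of degree below
  \<open>k\<close>: cancelling the leading term of \<open>q\<close> lowers its degree. Nothing is
  asked of \<open>p j\<close> for \<open>j \<ge> k\<close>, so finite families are covered.\<close>

lemma linear_functional_vanishes_below_degree:
  fixes p :: "nat \<Rightarrow> 'a::field poly" and L :: "'a poly \<Rightarrow> 'a"
  assumes add: "\<And>f g. L (f + g) = L f + L g" and smult: "\<And>c f. L (smult c f) = c * L f"
    and p: "\<And>j. j < k \<Longrightarrow> p j \<noteq> 0 \<and> degree (p j) = j \<and> L (p j) = 0"
    and "degree q < k"
  shows "L q = 0"
  using assms(4)
proof (induction "degree q" arbitrary: q rule: less_induct)
  case less
  define c where "c = lead_coeff q / lead_coeff (p (degree q))"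
  define r where "r = q - smult c (p (degree q))"
  have nz: "p (degree q) \<noteq> 0" and deg: "degree (p (degree q)) = degree q"
    using p less.prems by auto
  \<comment> \<open>Since \<open>degree 0 = 0\<close>, the induction hypothesis does not reach a
    zero remainder when \<open>q\<close> is constant.\<close>
  have L0: "L 0 = 0"
    using smult[of 0 0] by simp
  have "L r = 0"
  proof (cases "r = 0")
    case False
    have "degree r \<le> degree q"
      unfolding r_def using deg by (intro degree_diff_le) (auto intro: order.trans[OF degree_smult_le])
    moreover have "coeff (p (degree q)) (degree q) \<noteq> 0"
      using nz deg by (metis leading_coeff_0_iff)
    then have "coeff r (degree q) = 0"
      by (simp add: r_def c_def deg)
    ultimately have "degree r < degree q"
      using False by (metis le_neq_implies_less leading_coeff_0_iff)
    then show ?thesis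
      using less by auto
  qed (simp add: L0)
  moreover have "q = smult c (p (degree q)) + r"
    by (simp add: r_def)
  ultimately show ?case
    using add smult p[OF less.prems] by (metis add_0 mult_zero_right)
qed

section \<open>Derivative and recurrence of the Hermite polynomials\<close>

text \<open>Differentiating the defining recursion and inserting the induction hypothesis in both
  derivative terms reassembles that recursion one index lower.\<close>

lemma pderiv_hermite_rodrigues_Suc:
  "pderiv (hermite_rodrigues (Suc n)) = smult (2 * real (Suc n)) (hermite_rodrigues n)"
proof (induction n)
  case 0
  then show ?case by (simp add: pderiv_pCons)
next
  case (Suc n)
  let ?h = "hermite_rodrigues"
  have "pderiv (?h (Suc (Suc n))) =
      smult 2 (?h (Suc n)) + [:0, 2:] * pderiv (?h (Suc n)) - pderiv (pderiv (?h (Suc n)))"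
    by (subst hermite_rodrigues.simps) (simp add: pderiv_diff pderiv_mult pderiv_pCons
        del: hermite_rodrigues.simps mult_pCons_left)
  also have "\<dots> = smult 2 (?h (Suc n)) + smult (2 * real (Suc n)) ([:0, 2:] * ?h n - pderiv (?h n))"
    by (simp only: Suc pderiv_smult mult_smult_right smult_diff_right add_diff_eq)
  also have "[:0, 2:] * ?h n - pderiv (?h n) = ?h (Suc n)"
    by (simp only: hermite_rodrigues.simps)
  finally show ?case
    by (simp only: smult_add_left [symmetric]) (simp add: algebra_simps)
qed

lemma poly_hermite_rodrigues_Suc_Suc:
  "poly (hermite_rodrigues (Suc (Suc n))) x =
     2 * x * poly (hermite_rodrigues (Suc n)) x - 2 * real (Suc n) * poly (hermite_rodrigues n) x"
proof -
  have "hermite_rodrigues (Suc (Suc n)) = [:0, 2:] * hermite_rodrigues (Suc n)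
      - smult (2 * real (Suc n)) (hermite_rodrigues n)"
    unfolding hermite_rodrigues.simps(2)[of "Suc n"] pderiv_hermite_rodrigues_Suc ..
  then show ?thesis
    by (simp only: poly_diff poly_mult poly_smult) simp
qed

section \<open>Dual polynomials and their orthogonality on the zeros\<close>

text \<open>The monic Hermite recurrence has the coefficients \<open>k / 2\<close>; here they are
  read backwards, as \<open>(N - k) / 2\<close>.\<close>

fun dual_hermite :: "nat \<Rightarrow> nat \<Rightarrow> real poly" where
  "dual_hermite N 0 = 1"
| "dual_hermite N (Suc 0) = [:0, 1:]"
| "dual_hermite N (Suc (Suc k)) = [:0, 1:] * dual_hermite N (Suc k)
     - smult ((real N - real (Suc k)) / 2) (dual_hermite N k)"

lemma degree_lead_coeff_dual_hermite:
  "degree (dual_hermite N k) = k \<and> lead_coeff (dual_hermite N k) = 1"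
proof (induction N k rule: dual_hermite.induct)
  case (3 N k)
  let ?P = "dual_hermite N"
  let ?x = "[:0, 1:] * ?P (Suc k)" and ?y = "- smult ((real N - real (Suc k)) / 2) (?P k)"
  have eq: "?P (Suc (Suc k)) = ?y + ?x"
    by simp
  have "?P (Suc k) \<noteq> 0"
    using 3 by auto
  then have deg: "degree ?x = Suc (Suc k)"
    using 3 by (subst degree_mult_eq) auto
  have less: "degree ?y < degree ?x"
    unfolding deg using 3 by (simp add: le_imp_less_Suc less_Suc_eq_le)
  have "lead_coeff ?x = 1"
    unfolding lead_coeff_mult using 3 by auto
  then show ?case
    unfolding eq using degree_add_eq_right[OF less] lead_coeff_add_le[OF less] deg by simp
qed simp_all

lemma hermite_rodrigues_mult_dual_hermite:
  assumes "poly (hermite_rodrigues (Suc M)) x = 0" and "k \<le> M"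
  shows "poly (hermite_rodrigues M) x * poly (dual_hermite (Suc M) k) x =
    (\<Prod>j<k. real M - real j) * poly (hermite_rodrigues (M - k)) x"
  using assms(2)
proof (induction "Suc M" k rule: dual_hermite.induct)
  case 2
  then obtain m where "M = Suc m"
    by (cases M) auto
  \<comment> \<open>The assumption on \<open>x\<close> enters here: it removes the top term of the
    Hermite recurrence, which starts the downward run.\<close>
  moreover have "x * poly (hermite_rodrigues (Suc m)) x = real (Suc m) * poly (hermite_rodrigues m) x"
    using assms(1) poly_hermite_rodrigues_Suc_Suc[of m x] calculation
    by (simp add: algebra_simps del: hermite_rodrigues.simps)
  ultimately show ?case
    by (simp add: mult.commute del: hermite_rodrigues.simps)
next
  case (3 k)
  obtain m where M: "M = Suc (Suc (m + k))"
    using 3(3) by (metis add.commute add_Suc_right le_Suc_ex)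
  let ?h = "\<lambda>n. poly (hermite_rodrigues n) x"
  let ?P = "\<lambda>k. poly (dual_hermite (Suc M) k) x"
  let ?c = "\<Prod>j<k. real M - real j"
  have IH1: "?h M * ?P (Suc k) = ?c * (real M - real k) * ?h (Suc m)"
    using 3(1) M by simp
  have IH2: "?h M * ?P k = ?c * ?h (Suc (Suc m))"
    using 3(2) M by (simp del: hermite_rodrigues.simps add: Suc_diff_le)
  have "?h M * ?P (Suc (Suc k)) =
      x * (?h M * ?P (Suc k)) - (real M - real k) / 2 * (?h M * ?P k)"
    by (simp add: algebra_simps)
  \<comment> \<open>The last factor of the product in \<open>IH1\<close> is twice the recursion
    coefficient, so it comes out of both terms and leaves the Hermite recurrence solved for its
    lowest term.\<close>
  also have "\<dots> = ?c * (real M - real k) * (x * ?h (Suc m) - ?h (Suc (Suc m)) / 2)"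
    unfolding IH1 IH2 by (simp add: field_simps del: hermite_rodrigues.simps)
  also have "x * ?h (Suc m) - ?h (Suc (Suc m)) / 2 = real (Suc m) * ?h m"
    unfolding poly_hermite_rodrigues_Suc_Suc by (simp add: field_simps del: hermite_rodrigues.simps)
  also have "real (Suc m) = real M - real (Suc k)"
    using M by simp
  finally show ?case
    using M by simp
qed simp

lemma sum_dual_hermite_lower_degree:
  assumes A: "A = {x. poly (hermite_rodrigues (Suc M)) x = 0}" and card: "card A = Suc M"
    and "k \<le> M" and q: "degree q < k"
  shows "(\<Sum>a\<in>A. poly (dual_hermite (Suc M) k) a * poly q a) = 0"
proof -
  let ?h = "hermite_rodrigues"
  let ?c = "2 * real (Suc M) * (\<Prod>j<k. real M - real j)"
  let ?g = "?h (M - k) * q"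
  have deg: "degree (?h n) = n" for n
    using degree_lead_coeff_hermite_rodrigues by blast
  have nz: "?h (Suc M) \<noteq> 0"
    using deg[of "Suc M"] by (metis degree_0 nat.distinct(1))
  have roots: "poly (?h (Suc M)) a = 0" if "a \<in> A" for a
    using A that by blast
  have card': "card A = degree (?h (Suc M))"
    using card deg by metis
  have dg: "degree ?g < M"
    using q \<open>k \<le> M\<close> degree_mult_le[of "?h (M - k)" q] deg[of "M - k"] by linarith
  \<comment> \<open>Expanding by \<open>?h M\<close>, which is nonzero at \<open>a\<close> because
    the zeros are simple, turns the constant weights into reciprocals of the derivative.\<close>
  have eq: "poly (dual_hermite (Suc M) k) a * poly q a =
      ?c * (poly ?g a / poly (pderiv (?h (Suc M))) a)" if a: "a \<in> A" for a
  proof -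
    have der: "poly (pderiv (?h (Suc M))) a = 2 * real (Suc M) * poly (?h M) a"
      by (simp only: pderiv_hermite_rodrigues_Suc poly_smult)
    then have "poly (?h M) a \<noteq> 0"
      using pderiv_nonzero_at_roots[OF nz roots card' a] by auto
    then show ?thesis
      unfolding der
      using hermite_rodrigues_mult_dual_hermite[OF roots[OF a] \<open>k \<le> M\<close>]
      by (simp add: field_simps del: of_nat_Suc)
  qed
  have "(\<Sum>a\<in>A. poly (dual_hermite (Suc M) k) a * poly q a) =
      ?c * (\<Sum>a\<in>A. poly ?g a / poly (pderiv (?h (Suc M))) a)"
    unfolding sum_distrib_left using eq by (rule sum.cong[OF refl])
  also have "(\<Sum>a\<in>A. poly ?g a / poly (pderiv (?h (Suc M))) a) =
      coeff ?g (degree (?h (Suc M)) - 1) / lead_coeff (?h (Suc M))"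
    using dg by (intro sum_poly_div_pderiv_roots[OF nz roots card']) (simp_all only: deg)
  \<comment> \<open>The coefficient has degree \<open>M\<close>, while \<open>?g\<close> has degree
    at most \<open>M - k + degree q < M\<close>.\<close>
  also have "coeff ?g (degree (?h (Suc M)) - 1) = 0"
    unfolding deg using dg by (intro coeff_eq_0) simp
  finally show ?thesis
    by simp
qed

section \<open>Identification with the monic orthogonal polynomials\<close>

theorem proposition2p4:
  fixes N :: nat and z :: "nat \<Rightarrow> real" and Q :: "nat \<Rightarrow> real poly"
  assumes "N \<ge> 2"
    and "strict_mono_on {1..N} z"
    and "z ` {1..N} = {x. poly (hermite N) x = 0}"
    and "monic_orthogonal_polys (empirical_measure N z) {0..N-1} Q"
  shows "Q 0 = 1 \<and> Q 1 = [:0, 1:] \<and>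
    (\<forall>k\<in>{1..N-2}. Q (k + 1) = [:0, 1:] * Q k - smult ((real N - real k) / 2) (Q (k - 1)))"
proof -
  obtain M where N: "N = Suc M"
    using assms(1) by (cases N) auto
  define A where "A = z ` {1..N}"
  have A: "A = {x. poly (hermite_rodrigues (Suc M)) x = 0}"
    using assms(3) N by (simp only: A_def hermite_eq_rodrigues)
  have inj: "inj_on z {1..N}"
    using assms(2) by (rule strict_mono_on_imp_inj_on)
  \<comment> \<open>That all \<open>N\<close> zeros are real and distinct is read off from the
    enumeration \<open>z\<close>.\<close>
  have card: "card A = Suc M"
    using card_image[OF inj] by (simp add: A_def N)
  have fin: "finite A"
    by (simp add: A_def)
  have integral: "(LINT x|empirical_measure N z. poly p x * poly q x) =
      (\<Sum>a\<in>A. poly p a * poly q a) / real N" for p q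
    using assms(1) unfolding A_def sum.reindex[OF inj]
    by (subst integral_empirical_measure)
      (auto intro!: borel_measurable_continuous_onI continuous_intros)
  have deg: "degree (Q k) = k" and Qnz: "Q k \<noteq> 0" and lc: "lead_coeff (Q k) = 1" if "k \<le> M" for k
    using assms(4) that by (auto simp: monic_orthogonal_polys_def orthogonal_polys_def N)
  have orth: "(\<Sum>a\<in>A. poly (Q k) a * poly (Q j) a) = 0" if "k \<le> M" "j \<le> M" "k \<noteq> j" for j k
  proof -
    have "(LINT x|empirical_measure N z. poly (Q k) x * poly (Q j) x) = 0"
      using assms(4) that by (auto simp: monic_orthogonal_polys_def orthogonal_polys_def N)
    then show ?thesis
      unfolding integral using assms(1) by simp
  qed
  have lower: "(\<Sum>a\<in>A. poly (Q k) a * poly q a) = 0" if k: "k \<le> M" and "degree q < k" for k q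
  proof (rule linear_functional_vanishes_below_degree[where p = Q and k = k])
    show "Q j \<noteq> 0 \<and> degree (Q j) = j \<and> (\<Sum>a\<in>A. poly (Q k) a * poly (Q j) a) = 0" if "j < k" for j
      using that k deg Qnz orth by simp
  qed (use that in \<open>simp_all add: sum.distrib sum_distrib_left algebra_simps\<close>)
  have Q: "Q k = dual_hermite N k" if k: "k \<le> M" for k
  proof -
    let ?P = "dual_hermite N"
    define d where "d = Q k - ?P k"
    \<comment> \<open>Both polynomials are monic of degree \<open>k\<close> and orthogonal to lower
      degrees, so \<open>d\<close> is orthogonal to itself. A vanishing sum of squares then gives
      \<open>d\<close> more zeros than its degree allows.\<close>
    have "d = 0"
    proof (rule ccontr)
      assume nz: "d \<noteq> 0"
      have "degree d \<le> k"
        unfolding d_def using deg[OF k] degree_lead_coeff_dual_hermite[of N k]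
        by (intro degree_diff_le) auto
      moreover have "coeff d k = 0"
        using deg[OF k] lc[OF k] degree_lead_coeff_dual_hermite[of N k] by (auto simp: d_def)
      ultimately have less: "degree d < k"
        using nz by (metis le_neq_implies_less leading_coeff_0_iff)
      have "(\<Sum>a\<in>A. poly d a * poly d a) =
          (\<Sum>a\<in>A. poly (Q k) a * poly d a) - (\<Sum>a\<in>A. poly (?P k) a * poly d a)"
        by (simp add: sum_subtractf [symmetric] left_diff_distrib [symmetric] d_def)
      also have "\<dots> = 0"
        using lower[OF k less] sum_dual_hermite_lower_degree[OF A card k less] N by simp
      finally have "A \<subseteq> {x. poly d x = 0}"
        using fin by (subst (asm) sum_nonneg_eq_0_iff) auto
      then have "card A \<le> degree d"
        using card_poly_roots_bound[OF nz] poly_roots_finite[OF nz] by (meson card_mono order_trans)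
      then show False
        using card less k by simp
    qed
    then show ?thesis
      by (simp add: d_def)
  qed
  have "Q (k + 1) = [:0, 1:] * Q k - smult ((real N - real k) / 2) (Q (k - 1))"
    if k: "k \<in> {1..N-2}" for k
  proof -
    obtain j where j: "k = Suc j"
      using k by (cases k) auto
    have "Suc (Suc j) \<le> M"
      using k j N by auto
    then show ?thesis
      by (simp add: j Q)
  qed
  then show ?thesis
    using Q[of 0] Q[of 1] assms(1) N by simp
qed

end
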